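(* Let $a_1,\dots,a_n$ be real numbers, not all zero, let $X=\{(x_1,x_2,\dots,x_n)\in\mathbb{R}^n: a_1x_1+a_2x_2+\dots+a_nx_n=0\}$ be the corresponding $(n-1)$-dimensional subspace of the space $\ell_\infty^n$, and let $1\leq k\leq n$ be an integer for which there exist disjoint sets $A,B\subset\{1,2,\dots,n\}$ such that $|A|=k$, $|A\cup B|=n-1$ and $\sum_{i\in A}|a_i|\geq\sum_{i\in B}|a_i|$. Then $e(Y)\geq n-k$ for every $(n-1)$-dimensional real normed space $Y$ such that $d(X,Y)\leq 2$.
   Context: For a real finite-dimensional normed space $X$ with norm $\|\cdot\|$, a set $S\subset X$ is called equilateral if there is $p>0$ such that $\|x-y\|=p$ for all $x,y\in S$, $x\neq y$. The equilateral dimension $e(X)$ is the maximal cardinality of an equilateral set in $X$. The (multiplicative) Banach-Mazur distance between normed spaces $X,Y$ of the same finite dimension is $d(X,Y)=\inf\|T\|\cdot\|T^{-1}\|$, the infimum being over all linear invertible operators $T:X\to Y$. $\ell_\infty^n$ is $\mathbb{R}^n$ with the norm $\|x\|_\infty=\max_i|x_i|$; subspaces carry the restricted norm. The set $B$ may be empty (empty sums are $0$). *)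

theory Defs
  imports "HOL-Analysis.Analysis" "HOL-Library.Extended_Nat"
begin

text \<open>A normed space is given by a carrier \<open>V\<close>, a linear subspace of some real vector space type,
  together with a norm \<open>N\<close> on it; the values of \<open>N\<close> outside \<open>V\<close> are irrelevant.  In this way a
  subspace with the restricted norm is again a pair of the same kind.\<close>

definition normed_space_on :: "'a::real_vector set \<Rightarrow> ('a \<Rightarrow> real) \<Rightarrow> bool" where
  "normed_space_on V N \<longleftrightarrow>
     subspace V \<and>
     (\<forall>x\<in>V. 0 \<le> N x) \<and>
     (\<forall>x\<in>V. N x = 0 \<longleftrightarrow> x = 0) \<and>
     (\<forall>c. \<forall>x\<in>V. N (c *\<^sub>R x) = \<bar>c\<bar> * N x) \<and>
     (\<forall>x\<in>V. \<forall>y\<in>V. N (x + y) \<le> N x + N y)"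

text \<open>The library's \<^const>\<open>dim\<close> is also \<open>0\<close> on infinite-dimensional spaces, so the finite basis
  is required explicitly.\<close>

definition has_dimension :: "'a::real_vector set \<Rightarrow> nat \<Rightarrow> bool" where
  "has_dimension V d \<longleftrightarrow> (\<exists>D. finite D \<and> independent D \<and> span D = V \<and> card D = d)"

definition linear_map_on :: "'a::real_vector set \<Rightarrow> ('a \<Rightarrow> 'b::real_vector) \<Rightarrow> bool" where
  "linear_map_on V T \<longleftrightarrow>
     (\<forall>x\<in>V. \<forall>y\<in>V. T (x + y) = T x + T y) \<and> (\<forall>c. \<forall>x\<in>V. T (c *\<^sub>R x) = c *\<^sub>R T x)"

text \<open>As for the library's \<^const>\<open>onorm\<close>, the vector \<open>x = 0\<close> contributes \<open>0 / 0 = 0\<close>.\<close>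

definition op_norm_on ::
  "'a::real_vector set \<Rightarrow> ('a \<Rightarrow> real) \<Rightarrow> ('b::real_vector \<Rightarrow> real) \<Rightarrow> ('a \<Rightarrow> 'b) \<Rightarrow> real" where
  "op_norm_on V N M T = (SUP x\<in>V. M (T x) / N x)"

text \<open>Meaningful for \<open>V\<close> and \<open>W\<close> of the same finite dimension: then the infimum is over a nonempty
  set of nonnegative reals, and the suprema in the operator norms are finite.\<close>

definition banach_mazur_dist ::
  "'a::real_vector set \<Rightarrow> ('a \<Rightarrow> real) \<Rightarrow> 'b::real_vector set \<Rightarrow> ('b \<Rightarrow> real) \<Rightarrow> real" where
  "banach_mazur_dist V N W M =
     (INF T\<in>{T. linear_map_on V T \<and> bij_betw T V W}.
        op_norm_on V N M T * op_norm_on W M N (inv_into V T))"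

definition equilateral :: "'a::real_vector set \<Rightarrow> ('a \<Rightarrow> real) \<Rightarrow> 'a set \<Rightarrow> bool" where
  "equilateral V N S \<longleftrightarrow>
     S \<subseteq> V \<and> (\<exists>p>0. \<forall>x\<in>S. \<forall>y\<in>S. x \<noteq> y \<longrightarrow> N (x - y) = p)"

text \<open>The supremum is taken in \<^typ>\<open>enat\<close>, so that it has its intended value without a prior
  proof that the cardinalities are bounded.\<close>

definition equilateral_dim :: "'a::real_vector set \<Rightarrow> ('a \<Rightarrow> real) \<Rightarrow> enat" where
  "equilateral_dim V N =
     (SUP S\<in>{S. equilateral V N S}. if finite S then enat (card S) else \<infinity>)"

text \<open>Carrier of the subspace \<open>X\<close> of \<open>\<ell>\<^sub>\<infinity>\<^sup>n\<close>; the library's \<^const>\<open>infnorm\<close> is the maximum norm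
  on \<^typ>\<open>real ^ 'n\<close> (see \<open>infnorm_cart\<close>).\<close>

definition coeff_hyperplane :: "real ^ 'n \<Rightarrow> (real ^ 'n) set" where
  "coeff_hyperplane a = {x. (\<Sum>i\<in>UNIV. a $ i * x $ i) = 0}"

end

theory Submission
  imports Defs
begin

text \<open>The inequality between the two sums allows every vector supported on \<open>B\<close> to be completed on
  \<open>A\<close> to a vector of \<open>X\<close> without increasing its maximum norm, so \<open>X\<close> contains an isometric copy of
  \<open>\<ell>\<^sub>\<infinity>\<^sup>m\<close> with \<open>m = |B| = n - k - 1\<close>.  A norm on \<open>\<ell>\<^sub>\<infinity>\<^sup>m\<close> with distortion at most \<open>2 + \<delta>\<close> has \<open>m + 1\<close>
  points whose mutual distances lie in \<open>[1 - \<delta>, 1]\<close>, by Brouwer's theorem.  Since the infimum in the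
  Banach--Mazur distance is only approached, \<open>\<delta>\<close> cannot be taken to be \<open>0\<close> at once; instead these
  configurations, moved to \<open>Y\<close>, have a limit by compactness.\<close>

section \<open>Seminorms, linear maps between carriers and equivalence of norms\<close>

text \<open>Stated for total functions: the norm of \<open>Y\<close> is handled through its
  pullbacks along linear maps with range in \<open>Y\<close>, which are subadditive and homogeneous
  on the entire type. Definiteness is omitted because such a map may have a kernel.\<close>

definition seminorm :: "('a::real_vector \<Rightarrow> real) \<Rightarrow> bool" where
  "seminorm M \<longleftrightarrow> (\<forall>x y. M (x + y) \<le> M x + M y) \<and> (\<forall>c x. M (c *\<^sub>R x) = \<bar>c\<bar> * M x)"

lemma seminorm_minus_commute:
  assumes "seminorm M"
  shows "M (x - y) = M (y - x)"
proof -
  have "M ((-1) *\<^sub>R (y - x)) = \<bar>-1\<bar> * M (y - x)"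
    using assms unfolding seminorm_def by blast
  then show ?thesis by simp
qed

text \<open>Subadditivity and homogeneity give convexity, and a finite convex function on a
  Euclidean space is continuous.\<close>

lemma seminorm_continuous_on:
  fixes M :: "'a::euclidean_space \<Rightarrow> real"
  assumes "seminorm M"
  shows "continuous_on S M"
proof -
  have "convex_on UNIV M"
  proof (rule convex_onI)
    fix t :: real and x y :: 'a
    assume t: "0 < t" "t < 1"
    have "M ((1 - t) *\<^sub>R x + t *\<^sub>R y) \<le> M ((1 - t) *\<^sub>R x) + M (t *\<^sub>R y)"
      using assms unfolding seminorm_def by blast
    also have "\<dots> = \<bar>1 - t\<bar> * M x + \<bar>t\<bar> * M y"
      using assms unfolding seminorm_def by metis
    finally show "M ((1 - t) *\<^sub>R x + t *\<^sub>R y) \<le> (1 - t) * M x + t * M y"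
      using t by simp
  qed auto
  then show ?thesis
    using convex_on_continuous[OF open_UNIV] continuous_on_subset by blast
qed

lemma seminorm_compose_linear:
  assumes "normed_space_on Y N" "linear g" "range g \<subseteq> Y"
  shows "seminorm (\<lambda>x. N (g x))"
  using assms unfolding seminorm_def normed_space_on_def
  by (auto simp: linear_add linear_scale image_subset_iff)

text \<open>\<open>linear_map_on\<close> constrains \<open>T\<close> on \<open>V\<close> only.
  Extending from a basis of \<open>V\<close> gives a map that is linear on the whole type; its range
  stays in \<open>Y\<close>, so that \<open>N\<close> can be pulled back along it.\<close>

lemma linear_map_on_extend:
  assumes "subspace V" "subspace Y" "linear_map_on V T" "T ` V \<subseteq> Y"
  obtains g where "linear g" "range g \<subseteq> Y" "\<And>x. x \<in> V \<Longrightarrow> g x = T x"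
proof -
  obtain D where D: "D \<subseteq> V" "independent D" "V \<subseteq> span D"
    by (rule basis_exists[of V])
  obtain g where g: "linear g" "\<And>x. x \<in> D \<Longrightarrow> g x = T x" "range g = span (T ` D)"
    using linear_independent_extend_subspace[OF D(2), of T] by blast
  have "T ` D \<subseteq> Y"
    using D(1) assms(4) by blast
  then have "range g \<subseteq> Y"
    using g(3) assms(2) by (simp add: span_minimal)
  moreover have "subspace {x \<in> V. g x = T x}"
  proof (rule subspaceI)
    have "T (0 *\<^sub>R 0) = 0 *\<^sub>R T 0"
      using assms(1,3) subspace_0 unfolding linear_map_on_def by blast
    then show "0 \<in> {x \<in> V. g x = T x}"
      using assms(1) g(1) by (simp add: subspace_0 linear_0)
  qed (use assms(1,3) g(1) in \<open>auto simp: linear_map_on_def subspace_add subspace_scale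
        linear_add linear_scale\<close>)
  then have "span D \<subseteq> {x \<in> V. g x = T x}"
    using D(1) g(2) by (intro span_minimal) auto
  ultimately show ?thesis
    using that g(1) D(3) by blast
qed

text \<open>A bijection between bases extends linearly. The map shows that the infimum in
  \<open>banach_mazur_dist\<close> is over a nonempty set, and it later transports \<open>Y\<close>,
  whose type carries no topology, to a Euclidean subspace.\<close>

lemma linear_bijection_if_same_dimension:
  assumes "has_dimension V d" "has_dimension Y d"
  obtains g where "linear g" "range g \<subseteq> Y" "bij_betw g V Y"
proof -
  obtain D where D: "finite D" "independent D" "span D = V" "card D = d"
    using assms(1) by (auto simp: has_dimension_def)
  obtain E where E: "finite E" "independent E" "span E = Y" "card E = d"
    using assms(2) by (auto simp: has_dimension_def)
  obtain f where f: "bij_betw f D E"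
    using finite_same_card_bij[OF D(1) E(1)] D(4) E(4) by auto
  then have fD: "f ` D = E" "inj_on f D"
    by (auto simp: bij_betw_def)
  obtain g where g: "linear g" "\<forall>x\<in>D. g x = f x" "range g = span (f ` D)"
    using linear_independent_extend_subspace[OF D(2), of f] by blast
  have gD: "g ` D = E" "inj_on g D"
    using fD g(2) by (auto simp: inj_on_def)
  have "inj_on g V"
    using linear_inj_on_span_independent_image[OF g(1), of D] gD E(2) D(3) by simp
  moreover have "g ` V = Y"
    using linear_span_image[OF g(1), of D] gD(1) D(3) E(3) by simp
  ultimately show ?thesis
    using that g fD(1) E(3) by (simp add: bij_betw_def)
qed

text \<open>The constants are the extrema of the pulled-back norm on the compact unit sphere of
  \<open>V\<close>; injectivity makes the minimum positive. The zero subspace has an empty sphere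
  and is treated separately.\<close>

lemma norm_equivalent_linear_image:
  fixes V :: "'a::euclidean_space set"
  assumes "normed_space_on Y N" "subspace V" "linear g" "range g \<subseteq> Y" "inj_on g V"
  obtains m C where "0 < m" "0 \<le> C"
    "\<And>x. x \<in> V \<Longrightarrow> m * norm x \<le> N (g x)" "\<And>x. x \<in> V \<Longrightarrow> N (g x) \<le> C * norm x"
proof (cases "V \<subseteq> {0}")
  case True
  have "N (g 0) = 0"
    using assms by (simp add: linear_0 normed_space_on_def subspace_0)
  then show ?thesis
    using True that[of 1 0] by fastforce
next
  case False
  let ?K = "V \<inter> sphere 0 1"
  let ?M = "\<lambda>x. N (g x)"
  have sn: "seminorm ?M"
    using seminorm_compose_linear assms by blast
  have hom: "?M (c *\<^sub>R x) = \<bar>c\<bar> * ?M x" for c x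
    using sn unfolding seminorm_def by blast
  obtain v where v: "v \<in> V" "v \<noteq> 0"
    using False by auto
  have ne: "?K \<noteq> {}"
  proof -
    have "(1 / norm v) *\<^sub>R v \<in> ?K"
      using v assms(2) by (simp add: subspace_scale)
    then show ?thesis by blast
  qed
  have K: "compact ?K"
    using closed_subspace[OF assms(2)] by (simp add: closed_Int_compact)
  have cont: "continuous_on ?K ?M"
    using seminorm_continuous_on[OF sn] .
  obtain xm where xm: "xm \<in> ?K" "\<And>y. y \<in> ?K \<Longrightarrow> ?M xm \<le> ?M y"
    using continuous_attains_inf[OF K ne cont] by blast
  obtain xM where xM: "xM \<in> ?K" "\<And>y. y \<in> ?K \<Longrightarrow> ?M y \<le> ?M xM"
    using continuous_attains_sup[OF K ne cont] by blast
  have nonneg: "0 \<le> ?M x" for x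
    using assms(1,4) by (auto simp: normed_space_on_def)
  have "g xm \<noteq> g 0"
    using xm(1) assms(2,5) subspace_0[of V] by (metis IntD1 IntD2 inj_onD mem_sphere_0 norm_zero zero_neq_one)
  then have "?M xm \<noteq> 0"
    using assms(1,3,4) by (auto simp: normed_space_on_def linear_0)
  then have pos: "0 < ?M xm"
    using nonneg[of xm] by simp
  have bounds: "?M xm * norm x \<le> ?M x \<and> ?M x \<le> ?M xM * norm x" if x: "x \<in> V" for x
  proof (cases "x = 0")
    case True
    then show ?thesis using hom[of 0 0] by simp
  next
    case False
    have "(1 / norm x) *\<^sub>R x \<in> ?K"
      using False x assms(2) by (simp add: subspace_scale)
    then have "?M xm \<le> ?M ((1 / norm x) *\<^sub>R x)" "?M ((1 / norm x) *\<^sub>R x) \<le> ?M xM"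
      using xm xM by blast+
    then show ?thesis
      using False unfolding hom by (simp add: field_simps)
  qed
  show ?thesis
    using that[OF pos nonneg[of xM]] bounds by blast
qed

section \<open>From the Banach-Mazur distance to a map with controlled distortion\<close>

lemma infnorm_le_cart:
  fixes x :: "real^'n"
  assumes "\<And>i. \<bar>x $ i\<bar> \<le> c"
  shows "infnorm x \<le> c"
  unfolding infnorm_cart by (rule cSup_least) (use assms in auto)

text \<open>As \<open>D\<close> exceeds the infimum, some operator \<open>T\<close> satisfies
  \<open>p * q < D\<close>, where \<open>p\<close> and \<open>q\<close> are the operator norms of
  \<open>T\<close> and its inverse. Rescaling by \<open>c = 1 / p\<close> makes the upper constant 1
  and leaves a lower constant above \<open>1 / D\<close>.\<close>

lemma banach_mazur_distortion:
  fixes V :: "'a::euclidean_space set"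
  assumes Y: "normed_space_on Y N"
    and V: "subspace V" "has_dimension V d" "V \<noteq> {0}" and Yd: "has_dimension Y d"
    and less: "banach_mazur_dist V infnorm Y N < D"
  obtains g c where "linear g" "range g \<subseteq> Y" "0 < c"
    "\<And>x. x \<in> V \<Longrightarrow> infnorm x / D \<le> c * N (g x)" "\<And>x. x \<in> V \<Longrightarrow> c * N (g x) \<le> infnorm x"
proof -
  let ?T = "{T. linear_map_on V T \<and> bij_betw T V Y}"
  have subY: "subspace Y"
    using Y by (simp add: normed_space_on_def)
  obtain g0 where "linear g0" "bij_betw g0 V Y"
    by (rule linear_bijection_if_same_dimension[OF V(2) Yd])
  then have "g0 \<in> ?T"
    by (simp add: linear_map_on_def linear_add linear_scale)
  then have "?T \<noteq> {}"
    by blast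
  then obtain T where T: "linear_map_on V T" "bij_betw T V Y"
    and lt: "op_norm_on V infnorm N T * op_norm_on Y N infnorm (inv_into V T) < D"
    using cInf_lessD[of "(\<lambda>T. op_norm_on V infnorm N T * op_norm_on Y N infnorm (inv_into V T)) ` ?T"] less
    unfolding banach_mazur_dist_def by blast
  define p q where "p = op_norm_on V infnorm N T" and "q = op_norm_on Y N infnorm (inv_into V T)"
  have TV: "T ` V = Y" "inj_on T V"
    using T(2) by (auto simp: bij_betw_def)
  obtain g where g: "linear g" "range g \<subseteq> Y" "\<And>x. x \<in> V \<Longrightarrow> g x = T x"
    using linear_map_on_extend[OF V(1) subY T(1)] TV(1) by blast
  have inj: "inj_on g V"
    using TV(2) g(3) by (simp add: inj_on_def)
  obtain m C where mC: "0 < m" "0 \<le> C"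
    "\<And>x. x \<in> V \<Longrightarrow> m * norm x \<le> N (g x)" "\<And>x. x \<in> V \<Longrightarrow> N (g x) \<le> C * norm x"
    using norm_equivalent_linear_image[OF Y V(1) g(1,2) inj] by metis
  have Npos: "0 < N (g x)" if "x \<in> V" "x \<noteq> 0" for x
    using mC(1,3) that by (smt (verit, best) zero_less_mult_iff zero_less_norm_iff)
  have N0: "N (g 0) = 0"
    using g(1) Y subY by (simp add: linear_0 normed_space_on_def subspace_0)
  have p: "N (g x) \<le> p * infnorm x" if x: "x \<in> V" for x
  proof (cases "x = 0")
    case True
    then show ?thesis using N0 by (simp add: infnorm_0)
  next
    case False
    \<comment> \<open>The real supremum \<open>p\<close> is an upper bound only if the quotients are
      bounded; the factor \<open>sqrt DIM('a)\<close> compares \<open>norm\<close> with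
      \<open>infnorm\<close>.\<close>
    have "N (T y) / infnorm y \<le> C * sqrt DIM('a)" if "y \<in> V" for y
    proof (cases "y = 0")
      case True
      then show ?thesis using mC(2) by (simp add: infnorm_0)
    next
      case False
      have "N (g y) \<le> C * norm y"
        using mC(4) that by blast
      also have "\<dots> \<le> C * (sqrt DIM('a) * infnorm y)"
        using mC(2) norm_le_infnorm[of y] by (simp add: mult_left_mono)
      finally show ?thesis
        using False g(3) that infnorm_pos_lt[of y] by (simp add: field_simps)
    qed
    then have "bdd_above ((\<lambda>x. N (T x) / infnorm x) ` V)"
      by (auto simp: bdd_above_def)
    then have "N (T x) / infnorm x \<le> p"
      unfolding p_def op_norm_on_def using x by (rule cSUP_upper[rotated])
    then show ?thesis
      using False g(3) x infnorm_pos_lt[of x] by (simp add: field_simps)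
  qed
  have q: "infnorm x \<le> q * N (g x)" if x: "x \<in> V" for x
  proof (cases "x = 0")
    case True
    then show ?thesis using N0 by (simp add: infnorm_0)
  next
    case False
    \<comment> \<open>Boundedness for the inverse: \<open>m\<close> bounds \<open>N\<close> from
      below and \<open>infnorm z \<le> norm z\<close>. If \<open>N y = 0\<close>, the quotient is
      0.\<close>
    have "infnorm (inv_into V T y) / N y \<le> 1 / m" if y: "y \<in> Y" for y
    proof -
      obtain z where z: "z \<in> V" "y = T z"
        using y TV(1) by blast
      have "inv_into V T y = z"
        using z TV(2) by simp
      moreover have "m * infnorm z \<le> N y"
        using mC(1) mC(3)[OF z(1)] g(3)[OF z(1)] z(2) infnorm_le_norm[of z]
        by (smt (verit, best) mult_left_mono)
      moreover have "0 \<le> N y"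
        using y Y by (simp add: normed_space_on_def)
      ultimately show ?thesis
        using mC(1) by (cases "N y = 0") (auto simp: field_simps)
    qed
    then have "bdd_above ((\<lambda>y. infnorm (inv_into V T y) / N y) ` Y)"
      by (auto simp: bdd_above_def)
    then have "infnorm (inv_into V T (T x)) / N (T x) \<le> q"
      unfolding q_def op_norm_on_def using x TV(1) by (intro cSUP_upper) auto
    then show ?thesis
      using False g(3) x Npos[of x] TV(2) by (simp add: field_simps)
  qed
  \<comment> \<open>A nonzero vector forces both operator norms to be positive, which permits
    division by \<open>p\<close>.\<close>
  obtain v where v: "v \<in> V" "v \<noteq> 0"
    using V(1,3) subspace_0 by blast
  have pp: "0 < p"
    using p[OF v(1)] Npos[OF v] infnorm_pos_lt[of v] v(2)
    by (smt (verit, best) mult_le_0_iff)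
  have qp: "0 < q"
    using q[OF v(1)] Npos[OF v] infnorm_pos_lt[of v] v(2)
    by (smt (verit, best) mult_le_0_iff)
  have D: "p * q < D" "0 < D"
    using lt pp qp by (auto simp: p_def q_def intro: less_trans[OF mult_pos_pos])
  show ?thesis
  proof (rule that[OF g(1,2), of "1 / p"])
    fix x assume x: "x \<in> V"
    have "infnorm x * p \<le> p * q * N (g x)"
      using q[OF x] pp by (simp add: mult.assoc mult.commute[of _ p] mult_left_mono)
    also have "\<dots> \<le> D * N (g x)"
      using D(1) Npos[OF x] N0 by (cases "x = 0") auto
    finally show "infnorm x / D \<le> 1 / p * N (g x)"
      using pp D(2) by (simp add: field_simps)
    show "1 / p * N (g x) \<le> infnorm x"
      using p[OF x] pp by (simp add: field_simps)
  qed (use pp in auto)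
qed

section \<open>Almost equilateral configurations from Brouwer's theorem\<close>

text \<open>The points are perturbations of \<open>0\<close> (for \<open>b\<close>) and \<open>- e\<^sub>i\<close> by parameters
  \<open>E (l, i) \<in> [0, 1]\<close> for \<open>l\<close> of smaller rank than \<open>i\<close>, such that the parameter \<open>E (i, j)\<close> alone
  determines the maximum distance \<open>1 + E (i, j)\<close> of the \<open>i\<close>-th and \<open>j\<close>-th point.  A fixed point of
  the truncated correction \<open>E + 1 - M\<close> makes all distances with respect to \<open>M\<close> almost \<open>1\<close>.\<close>

lemma near_equilateral:
  fixes M :: "real^'n \<Rightarrow> real"
  assumes M: "seminorm M" and D: "2 \<le> D" and b: "b \<notin> B"
    and bounds: "\<And>y. \<forall>l\<in>-B. y $ l = 0 \<Longrightarrow> infnorm y / D \<le> M y \<and> M y \<le> infnorm y"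
  obtains p :: "'n \<Rightarrow> real^'n"
  where "\<And>i j. i \<in> insert b B \<Longrightarrow> j \<in> insert b B \<Longrightarrow> i \<noteq> j \<Longrightarrow> 2 / D \<le> M (p i - p j) \<and> M (p i - p j) \<le> 1"
proof -
  obtain r0 :: "'n \<Rightarrow> nat" and h where r0: "r0 ` UNIV = {i. i < h}" "inj r0"
    using finite_imp_inj_to_nat_seg[of "UNIV :: 'n set"] by auto
  \<comment> \<open>The value \<open>h\<close> exceeds all values of \<open>r0\<close>, so
    \<open>b\<close> has the top rank. The lower-ranked index of any pair then lies in
    \<open>B\<close>, where it has a coordinate of its own.\<close>
  define r where "r = r0(b := h)"
  have r0h: "r0 i < h" for i
    using r0(1) by blast
  then have r: "inj r" "\<And>l. l \<noteq> b \<Longrightarrow> r l < r b"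
    using r0(2) by (auto simp: r_def inj_on_def less_imp_neq)
  define P :: "real^('n \<times> 'n) \<Rightarrow> 'n \<Rightarrow> real^'n" where
    "P E i = (\<chi> l. if l \<notin> B then 0 else if l = i then -1 else if r l < r i then E $ (l, i) else 0)" for E i
  define F :: "real^('n \<times> 'n) \<Rightarrow> real^('n \<times> 'n)" where
    "F E = (\<chi> z. max 0 (min 1 (E $ z + 1 - M (P E (fst z) - P E (snd z)))))" for E
  have contP: "continuous_on S (\<lambda>E. P E i)" for S i
    unfolding P_def
  proof (rule continuous_on_vec_lambda)
    fix l
    show "continuous_on S (\<lambda>E. if l \<notin> B then 0 else if l = i then -1 else if r l < r i then E $ (l, i) else 0)"
      by (cases "l \<in> B"; cases "l = i"; cases "r l < r i") (simp_all add: continuous_intros)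
  qed
  have contM: "continuous_on S (\<lambda>E. M (P E i - P E j))" for S i j
    by (rule continuous_on_compose2[OF seminorm_continuous_on[OF M, of UNIV]])
      (auto intro!: continuous_intros contP)
  have "continuous_on (cbox 0 1) F"
    unfolding F_def
    by (intro continuous_on_vec_lambda continuous_intros contM)
  moreover have "F \<in> cbox 0 1 \<rightarrow> cbox 0 1"
    by (auto simp: mem_box_cart F_def)
  moreover have "(0 :: real^('n \<times> 'n)) \<in> cbox 0 1"
    by (simp add: mem_box_cart)
  ultimately obtain E where E: "E \<in> cbox 0 1" "F E = E"
    using brouwer[of "cbox 0 (1 :: real^('n \<times> 'n))" F] by (metis compact_cbox convex_box(1) empty_iff)
  have E01: "0 \<le> E $ z" "E $ z \<le> 1" for z
    using E(1) by (simp_all add: mem_box_cart del: split_paired_All)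
  have *: "2 / D \<le> M (P E i - P E j) \<and> M (P E i - P E j) \<le> 1"
    if ij: "i \<in> insert b B" "j \<in> insert b B" "r i < r j" for i j
  proof -
    let ?e = "E $ (i, j)"
    have iB: "i \<in> B"
      using ij r(2)[of j] by (metis insertE less_asym less_irrefl)
    \<comment> \<open>At coordinate \<open>i\<close> the difference is \<open>- (1 + ?e)\<close>; at
      \<open>j\<close> it has absolute value at most 1. At every other coordinate both entries lie
      in [0, 1], so they differ by at most 1.\<close>
    have le: "infnorm (P E i - P E j) \<le> 1 + ?e"
    proof (rule infnorm_le_cart)
      fix l
      show "\<bar>(P E i - P E j) $ l\<bar> \<le> 1 + ?e"
        using ij(3) E01[of "(i, j)"] E01[of "(l, i)"] E01[of "(l, j)"] by (auto simp: P_def)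
    qed
    have "(P E i - P E j) $ i = - (1 + ?e)"
      using iB ij(3) by (auto simp: P_def)
    then have ge: "1 + ?e \<le> infnorm (P E i - P E j)"
      using component_le_infnorm_cart[of "P E i - P E j" i] E01[of "(i, j)"] by simp
    have "\<forall>l\<in>-B. (P E i - P E j) $ l = 0"
      by (simp add: P_def)
    then have M1: "(1 + ?e) / D \<le> M (P E i - P E j)" "M (P E i - P E j) \<le> 1 + ?e"
      using bounds[of "P E i - P E j"] le ge by auto
    have fixed: "?e = max 0 (min 1 (?e + 1 - M (P E i - P E j)))"
      using arg_cong[OF E(2), of "\<lambda>E. E $ (i, j)"] by (simp add: F_def)
    \<comment> \<open>If \<open>M\<close> is at least \<open>?e\<close>, truncation at 1 has no
      effect; truncation at 0 can act only when \<open>?e = 0\<close>, and then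
      \<open>M \<le> 1 + ?e\<close> still gives \<open>M = 1\<close>. Otherwise
      \<open>?e = 1\<close>, and the lower bound becomes \<open>2 / D\<close> while
      \<open>M < 1\<close>.\<close>
    show ?thesis
    proof (cases "M (P E i - P E j) \<ge> ?e")
      case True
      then have "M (P E i - P E j) = 1"
        using fixed M1(2) by (simp add: max_def min_def split: if_splits)
      then show ?thesis using D by simp
    next
      case False
      then have "?e = 1"
        using fixed by (simp add: max_def min_def split: if_splits)
      then show ?thesis
        using M1 False by simp
    qed
  qed
  show ?thesis
  proof (rule that[of "P E"])
    fix i j assume ij: "i \<in> insert b B" "j \<in> insert b B" "i \<noteq> j"
    then have "r i < r j \<or> r j < r i"
      using r(1) by (metis injD linorder_neqE_nat)
    then show "2 / D \<le> M (P E i - P E j) \<and> M (P E i - P E j) \<le> 1"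
      using *[OF ij(1,2)] *[OF ij(2,1)] seminorm_minus_commute[OF M] by metis
  qed
qed

section \<open>Passage to the limit by compactness\<close>

text \<open>After translation the approximate configurations lie in a compact set of tuples, because
  \<open>M\<close> dominates a multiple of the Euclidean norm on \<open>V\<close>. Continuity of
  \<open>M\<close> makes all distances exactly 1 at a subsequential limit.\<close>

lemma equilateral_limit:
  fixes V :: "'a::euclidean_space set" and I :: "'i::finite set"
  assumes M: "seminorm M" and V: "subspace V"
    and m: "0 < m" "\<And>x. x \<in> V \<Longrightarrow> m * norm x \<le> M x"
    and near: "\<And>\<delta>. 0 < \<delta> \<Longrightarrow> \<exists>q. (\<forall>i\<in>I. q i \<in> V) \<and>
      (\<forall>i\<in>I. \<forall>j\<in>I. i \<noteq> j \<longrightarrow> \<bar>M (q i - q j) - 1\<bar> \<le> \<delta>)"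
  obtains q where "\<And>i. i \<in> I \<Longrightarrow> q i \<in> V"
    "\<And>i j. i \<in> I \<Longrightarrow> j \<in> I \<Longrightarrow> i \<noteq> j \<Longrightarrow> M (q i - q j) = 1"
proof (cases "I = {}")
  case True
  then show ?thesis using that by blast
next
  case False
  then obtain i0 where i0: "i0 \<in> I" by blast
  \<comment> \<open>The radius comes from \<open>m * norm x \<le> M x \<le> 2\<close>: distances to
    the base point are at most 1 plus an error of at most 1.\<close>
  define K :: "('a^'i) set" where "K = {Q. \<forall>i. Q $ i \<in> V \<inter> cball 0 (2 / m)}"
  have "\<exists>Q\<in>K. \<forall>i\<in>I. \<forall>j\<in>I. i \<noteq> j \<longrightarrow> \<bar>M (Q $ i - Q $ j) - 1\<bar> \<le> inverse (real (Suc n))" for n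
  proof -
    obtain q where q: "\<And>i. i \<in> I \<Longrightarrow> q i \<in> V"
      "\<And>i j. i \<in> I \<Longrightarrow> j \<in> I \<Longrightarrow> i \<noteq> j \<Longrightarrow> \<bar>M (q i - q j) - 1\<bar> \<le> inverse (real (Suc n))"
      using near[of "inverse (real (Suc n))"] by auto
    \<comment> \<open>Moving \<open>q i0\<close> to the origin preserves differences and yields
      boundedness; indices outside \<open>I\<close> are filled with 0.\<close>
    define Q :: "'a^'i" where "Q = (\<chi> i. if i \<in> I then q i - q i0 else 0)"
    have "Q $ i \<in> V \<inter> cball 0 (2 / m)" for i
    proof (cases "i \<in> I \<and> i \<noteq> i0")
      case True
      then have qv: "q i - q i0 \<in> V"
        using q(1) i0 V by (simp add: subspace_diff)
      have "inverse (real (Suc n)) \<le> 1"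
        by (simp add: field_simps)
      then have "M (q i - q i0) \<le> 2"
        using q(2)[of i i0] True i0 by linarith
      then have "m * norm (q i - q i0) \<le> 2"
        using m(2)[OF qv] by linarith
      then show ?thesis
        using qv True m(1) by (simp add: Q_def field_simps)
    next
      case False
      then show ?thesis
        using V m(1) by (auto simp: Q_def subspace_0)
    qed
    then have "Q \<in> K" by (simp add: K_def)
    then show ?thesis
      using q(2) by (intro bexI[of _ Q]) (auto simp: Q_def)
  qed
  then obtain Q where Q: "\<And>n. Q n \<in> K"
    "\<And>n i j. i \<in> I \<Longrightarrow> j \<in> I \<Longrightarrow> i \<noteq> j \<Longrightarrow> \<bar>M (Q n $ i - Q n $ j) - 1\<bar> \<le> inverse (real (Suc n))"
    by metis
  have "compact K"
  proof -
    have "norm Q \<le> real CARD('i) * (2 / m)" if "Q \<in> K" for Q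
    proof -
      have "norm Q \<le> (\<Sum>i\<in>UNIV. norm (Q $ i))"
        unfolding norm_vec_def by (rule L2_set_le_sum) auto
      also have "\<dots> \<le> (\<Sum>i\<in>(UNIV::'i set). 2 / m)"
        using that by (intro sum_mono) (auto simp: K_def)
      finally show ?thesis by simp
    qed
    then have "bounded K" by (auto simp: bounded_iff)
    moreover have "closed K"
    proof -
      have "K = (\<Inter>i. (\<lambda>Q. Q $ i) -` (V \<inter> cball 0 (2 / m)))"
        by (auto simp: K_def)
      moreover have "closed ((\<lambda>Q :: 'a^'i. Q $ i) -` (V \<inter> cball 0 (2 / m)))" for i
        using closed_subspace[OF V] by (intro closed_vimage_vec_nth closed_Int) auto
      ultimately show ?thesis by auto
    qed
    ultimately show ?thesis by (simp add: compact_eq_bounded_closed)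
  qed
  then obtain L s where L: "L \<in> K" "strict_mono s" "(Q \<circ> s) \<longlonglongrightarrow> L"
    using Q(1) unfolding compact_def by blast
  have "M (L $ i - L $ j) = 1" if "i \<in> I" "j \<in> I" "i \<noteq> j" for i j
  proof -
    have "(\<lambda>n. Q (s n) $ i - Q (s n) $ j) \<longlonglongrightarrow> L $ i - L $ j"
      using L(3) by (auto simp: o_def intro!: tendsto_intros)
    moreover have "isCont M (L $ i - L $ j)"
      using seminorm_continuous_on[OF M, of UNIV] by (simp add: continuous_on_eq_continuous_at)
    ultimately have "(\<lambda>n. M (Q (s n) $ i - Q (s n) $ j)) \<longlonglongrightarrow> M (L $ i - L $ j)"
      by (rule isCont_tendsto_compose[rotated])
    moreover have "(\<lambda>n. M (Q (s n) $ i - Q (s n) $ j)) \<longlonglongrightarrow> 1"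
    proof (rule LIMSEQ_I)
      have lim: "((\<lambda>n. inverse (real (Suc n))) \<circ> s) \<longlonglongrightarrow> 0"
        using LIMSEQ_inverse_real_of_nat L(2) by (rule LIMSEQ_subseq_LIMSEQ)
      fix e :: real assume "0 < e"
      then obtain n0 where "\<And>n. n \<ge> n0 \<Longrightarrow> inverse (real (Suc (s n))) < e"
        using LIMSEQ_D[OF lim] by (auto simp: o_def)
      then show "\<exists>n0. \<forall>n\<ge>n0. norm (M (Q (s n) $ i - Q (s n) $ j) - 1) < e"
        using Q(2)[OF that] by (metis le_less_trans real_norm_def)
    qed
    ultimately show ?thesis
      by (rule LIMSEQ_unique)
  qed
  then show ?thesis
    using that[of "\<lambda>i. L $ i"] L(1) by (auto simp: K_def)
qed

section \<open>The isometric copy of a maximum-norm space inside the hyperplane\<close>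

text \<open>An entry \<open>- sgn (a $ i) * t y\<close> at \<open>i\<close> in \<open>A\<close>
  contributes \<open>- \<bar>a $ i\<bar> * t y\<close>, so together these cancel the sum over
  \<open>B\<close>. The inequality between the two sums keeps \<open>\<bar>t y\<bar>\<close> at most
  \<open>infnorm y\<close>.\<close>

lemma infnorm_preserving_embedding:
  fixes a :: "real^'n"
  assumes "A \<inter> B = {}" "(\<Sum>i\<in>B. \<bar>a $ i\<bar>) \<le> (\<Sum>i\<in>A. \<bar>a $ i\<bar>)"
  obtains L :: "real^'n \<Rightarrow> real^'n" where "linear L" "range L \<subseteq> coeff_hyperplane a"
    "\<And>y. \<forall>l\<in>-B. y $ l = 0 \<Longrightarrow> infnorm (L y) = infnorm y"
proof -
  define \<alpha> where "\<alpha> = (\<Sum>i\<in>A. \<bar>a $ i\<bar>)"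
  define t where "t y = (\<Sum>i\<in>B. a $ i * y $ i) / \<alpha>" for y :: "real^'n"
  define L :: "real^'n \<Rightarrow> real^'n" where
    "L y = (\<chi> i. if i \<in> B then y $ i else if i \<in> A then - sgn (a $ i) * t y else 0)" for y
  have t: "t (x + y) = t x + t y" "t (c *\<^sub>R x) = c * t x" for x y c
    by (simp_all add: t_def distrib_left sum.distrib add_divide_distrib sum_distrib_left mult.left_commute)
  have lin: "linear L"
    by (rule linearI) (auto simp: L_def vec_eq_iff t algebra_simps)
  have sum_le: "\<bar>\<Sum>i\<in>B. a $ i * y $ i\<bar> \<le> \<alpha> * c" if "\<And>i. \<bar>y $ i\<bar> \<le> c" "0 \<le> c" for y c
  proof -
    have "\<bar>\<Sum>i\<in>B. a $ i * y $ i\<bar> \<le> (\<Sum>i\<in>B. \<bar>a $ i\<bar> * c)"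
      by (rule order_trans[OF sum_abs]) (auto simp: abs_mult that intro!: sum_mono mult_left_mono)
    also have "\<dots> \<le> \<alpha> * c"
      using assms(2) that(2) by (simp add: \<alpha>_def flip: sum_distrib_right) (simp add: mult_right_mono)
    finally show ?thesis .
  qed
  have \<alpha>: "0 \<le> \<alpha>" by (simp add: \<alpha>_def sum_nonneg)
  \<comment> \<open>If \<open>\<alpha> = 0\<close>, then \<open>t y = 0\<close> by division by zero,
    and \<open>sum_le\<close> makes the sum over \<open>B\<close> vanish as well.\<close>
  have cancel: "\<alpha> * t y = (\<Sum>i\<in>B. a $ i * y $ i)" for y
    using sum_le[OF component_le_infnorm_cart infnorm_pos_le, of y] by (cases "\<alpha> = 0") (auto simp: t_def)
  have "L y \<in> coeff_hyperplane a" for y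
  proof -
    have "(\<Sum>i\<in>UNIV. a $ i * L y $ i) =
        (\<Sum>i\<in>UNIV. (if i \<in> B then a $ i * y $ i else 0) + (if i \<in> A then - \<bar>a $ i\<bar> * t y else 0))"
      using assms(1) by (intro sum.cong) (auto simp: L_def abs_sgn)
    also have "\<dots> = (\<Sum>i\<in>B. a $ i * y $ i) - \<alpha> * t y"
      by (simp add: sum.distrib sum.If_cases \<alpha>_def sum_distrib_right sum_negf)
    finally show ?thesis
      using cancel by (simp add: coeff_hyperplane_def)
  qed
  moreover have "infnorm (L y) = infnorm y" if y: "\<forall>l\<in>-B. y $ l = 0" for y
  proof (rule antisym)
    have "\<bar>\<Sum>i\<in>B. a $ i * y $ i\<bar> \<le> \<alpha> * infnorm y"
      by (rule sum_le[OF component_le_infnorm_cart infnorm_pos_le])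
    then have tb: "\<bar>t y\<bar> \<le> infnorm y"
      using \<alpha> infnorm_pos_le[of y] by (cases "\<alpha> = 0") (auto simp: t_def field_simps abs_divide)
    show "infnorm (L y) \<le> infnorm y"
    proof (rule infnorm_le_cart)
      fix i
      have "\<bar>sgn (a $ i) * t y\<bar> \<le> \<bar>t y\<bar>"
        by (simp add: abs_mult abs_sgn_eq)
      then show "\<bar>L y $ i\<bar> \<le> infnorm y"
        using tb infnorm_pos_le[of y] component_le_infnorm_cart[of y i] by (auto simp: L_def)
    qed
    show "infnorm y \<le> infnorm (L y)"
    proof (rule infnorm_le_cart)
      fix i
      show "\<bar>y $ i\<bar> \<le> infnorm (L y)"
        using component_le_infnorm_cart[of "L y" i] y infnorm_pos_le[of "L y"]
        by (cases "i \<in> B") (auto simp: L_def)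
    qed
  qed
  ultimately show ?thesis
    using that[OF lin] by blast
qed

section \<open>The hyperplane as an orthogonal complement, and its dimension\<close>

lemma coeff_hyperplane_inner: "coeff_hyperplane a = {x. a \<bullet> x = 0}"
  by (simp add: coeff_hyperplane_def inner_vec_def)

lemma has_dimension_coeff_hyperplane:
  fixes a :: "real^'n"
  assumes "a \<noteq> 0"
  shows "has_dimension (coeff_hyperplane a) (CARD('n) - 1)"
proof -
  obtain D where D: "D \<subseteq> coeff_hyperplane a" "independent D" "coeff_hyperplane a \<subseteq> span D"
    "card D = dim (coeff_hyperplane a)"
    using basis_exists[of "coeff_hyperplane a"] by blast
  have "span D = coeff_hyperplane a"
    using D(1,3) by (simp add: coeff_hyperplane_inner subspace_hyperplane span_subspace)
  then show ?thesis
    using D(2,4) assms dim_hyperplane[of a] finiteI_independent[OF D(2)]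
    by (auto simp: has_dimension_def coeff_hyperplane_inner)
qed

section \<open>Transfer of the configurations to \<open>Y\<close> and their limit\<close>

theorem theorem1p11:
  fixes a :: "real ^ 'n"
    and k :: nat
    and Y :: "'b::real_vector set"
    and N :: "'b \<Rightarrow> real"
  assumes a_nonzero: "\<exists>i. a $ i \<noteq> 0"
    and k_range: "1 \<le> k" "k \<le> CARD('n)"
    and AB: "\<exists>A B :: 'n set. A \<inter> B = {} \<and> card A = k \<and> card (A \<union> B) = CARD('n) - 1 \<and>
               (\<Sum>i\<in>A. \<bar>a $ i\<bar>) \<ge> (\<Sum>i\<in>B. \<bar>a $ i\<bar>)"
    and Y_normed: "normed_space_on Y N"
    and Y_dim: "has_dimension Y (CARD('n) - 1)"
    and dist: "banach_mazur_dist (coeff_hyperplane a) infnorm Y N \<le> 2"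
  shows "equilateral_dim Y N \<ge> enat (CARD('n) - k)"
proof -
  let ?X = "coeff_hyperplane a"
  obtain A B :: "'n set" where AB: "A \<inter> B = {}" "card A = k" "card (A \<union> B) = CARD('n) - 1"
    "(\<Sum>i\<in>B. \<bar>a $ i\<bar>) \<le> (\<Sum>i\<in>A. \<bar>a $ i\<bar>)"
    using AB by blast
  have cardAB: "card A + card B = CARD('n) - 1"
    using AB(1,3) card_Un_disjoint[of A B] by simp
  have "A \<union> B \<noteq> UNIV"
    using AB(3) by (metis card_gt_0_iff diff_less finite less_irrefl UNIV_not_empty zero_less_one)
  then obtain b where b: "b \<notin> B"
    by blast
  \<comment> \<open>The indices of the future points: \<open>B\<close> has
    \<open>CARD('n) - 1 - k\<close> elements, and \<open>b\<close> supplies one more.\<close>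
  let ?I = "insert b B"
  have cardI: "card ?I = CARD('n) - k"
    using b cardAB AB(2) k_range by simp
  have a0: "a \<noteq> 0"
    using a_nonzero by auto
  have subX: "subspace ?X"
    by (simp add: coeff_hyperplane_inner subspace_hyperplane)
  have subY: "subspace Y"
    using Y_normed by (simp add: normed_space_on_def)
  have dimX: "has_dimension ?X (CARD('n) - 1)"
    using has_dimension_coeff_hyperplane[OF a0] .
  \<comment> \<open>A trivial hyperplane would mean \<open>CARD('n) = 1\<close> and hence an empty
    \<open>A\<close>, against \<open>1 \<le> k\<close>.\<close>
  have Xne: "?X \<noteq> {0}"
  proof
    assume "?X = {0}"
    then have "CARD('n) - 1 = 0"
      using dim_hyperplane[OF a0] by (simp add: coeff_hyperplane_inner)
    then show False
      using cardAB AB(2) k_range by simp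
  qed
  obtain L :: "real^'n \<Rightarrow> real^'n" where L: "linear L" "range L \<subseteq> ?X"
    "\<And>y. \<forall>l\<in>-B. y $ l = 0 \<Longrightarrow> infnorm (L y) = infnorm y"
    using infnorm_preserving_embedding[OF AB(1,4)] by metis
  \<comment> \<open>The map \<open>g\<close> below varies with \<open>\<delta>\<close>; this fixed
    \<open>h\<close> places all configurations in the single Euclidean subspace \<open>?X\<close>,
    where a limit can be taken.\<close>
  obtain h where h: "linear h" "range h \<subseteq> Y" "bij_betw h ?X Y"
    by (rule linear_bijection_if_same_dimension[OF dimX Y_dim])
  have hX: "h ` ?X = Y" "inj_on h ?X"
    using h(3) by (auto simp: bij_betw_def)
  obtain m C where m: "0 < m" "\<And>x. x \<in> ?X \<Longrightarrow> m * norm x \<le> N (h x)"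
    using norm_equivalent_linear_image[OF Y_normed subX h(1,2) hX(2)] by metis
  have near: "\<exists>q. (\<forall>i\<in>?I. q i \<in> ?X) \<and>
      (\<forall>i\<in>?I. \<forall>j\<in>?I. i \<noteq> j \<longrightarrow> \<bar>N (h (q i - q j)) - 1\<bar> \<le> \<delta>)" if \<delta>: "0 < \<delta>" for \<delta>
  proof -
    have "banach_mazur_dist ?X infnorm Y N < 2 + \<delta>"
      using dist \<delta> by simp
    then obtain g c where g: "linear g" "range g \<subseteq> Y" and c: "0 < c"
      and gc: "\<And>x. x \<in> ?X \<Longrightarrow> infnorm x / (2 + \<delta>) \<le> c * N (g x)"
        "\<And>x. x \<in> ?X \<Longrightarrow> c * N (g x) \<le> infnorm x"
      using banach_mazur_distortion[OF Y_normed subX dimX Xne Y_dim] by metis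
    \<comment> \<open>Composition with \<open>L\<close> carries the distortion bounds from
      \<open>?X\<close> to vectors supported on \<open>B\<close>, as \<open>near_equilateral\<close>
      requires with \<open>D = 2 + \<delta>\<close>.\<close>
    define G where "G y = c *\<^sub>R g (L y)" for y
    have G: "linear G" "range G \<subseteq> Y"
      using linear_compose_scale_right[OF linear_compose[OF L(1) g(1)], of c] g(2) subY
      by (auto simp: G_def[abs_def] o_def subspace_scale image_subset_iff)
    have NG: "N (G y) = c * N (g (L y))" for y
      using Y_normed g(2) c by (simp add: G_def normed_space_on_def image_subset_iff)
    have LX: "L y \<in> ?X" for y
      using L(2) by blast
    obtain p where p: "\<And>i j. i \<in> ?I \<Longrightarrow> j \<in> ?I \<Longrightarrow> i \<noteq> j \<Longrightarrow>
        2 / (2 + \<delta>) \<le> N (G (p i - p j)) \<and> N (G (p i - p j)) \<le> 1"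
    proof (rule near_equilateral[OF seminorm_compose_linear[OF Y_normed G] _ b, of "2 + \<delta>"])
      fix y :: "real^'n" assume "\<forall>l\<in>-B. y $ l = 0"
      then have "infnorm (L y) = infnorm y"
        using L(3) by blast
      then show "infnorm y / (2 + \<delta>) \<le> N (G y) \<and> N (G y) \<le> infnorm y"
        using gc[OF LX[of y]] by (simp add: NG)
    qed (use \<delta> in auto)
    define q where "q i = inv_into ?X h (G (p i))" for i
    have q: "q i \<in> ?X" "h (q i) = G (p i)" for i
      using hX(1) G(2) by (auto simp: q_def intro!: inv_into_into f_inv_into_f)
    \<comment> \<open>This is \<open>(1 - \<delta>) * (2 + \<delta>) \<le> 2\<close>, expanded as 2
      minus \<open>\<delta>\<close> minus its square.\<close>
    have "2 / (2 + \<delta>) \<ge> 1 - \<delta>"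
      using \<delta> by (simp add: field_simps)
    then have "\<bar>N (h (q i - q j)) - 1\<bar> \<le> \<delta>" if "i \<in> ?I" "j \<in> ?I" "i \<noteq> j" for i j
      using p[OF that] \<delta> by (simp add: linear_diff[OF h(1)] linear_diff[OF G(1)] q)
    then show ?thesis
      using q(1) by blast
  qed
  obtain q where q: "\<And>i. i \<in> ?I \<Longrightarrow> q i \<in> ?X"
    "\<And>i j. i \<in> ?I \<Longrightarrow> j \<in> ?I \<Longrightarrow> i \<noteq> j \<Longrightarrow> N (h (q i - q j)) = 1"
    using equilateral_limit[OF seminorm_compose_linear[OF Y_normed h(1,2)] subX m near] by metis
  define S where "S = (\<lambda>i. h (q i)) ` ?I"
  have dist1: "N (h (q i) - h (q j)) = 1" if "i \<in> ?I" "j \<in> ?I" "i \<noteq> j" for i j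
    using q(2)[OF that] by (simp add: linear_diff[OF h(1)])
  have "N 0 = 0"
    using Y_normed subY by (simp add: normed_space_on_def subspace_0)
  \<comment> \<open>Coinciding images of distinct indices would be at distance both 0 and 1, so no
    points are lost in \<open>S\<close>.\<close>
  then have "inj_on (\<lambda>i. h (q i)) ?I"
    using dist1 unfolding inj_on_def by (metis diff_self zero_neq_one)
  then have cardS: "card S = CARD('n) - k"
    using cardI unfolding S_def by (metis card_image)
  have "S \<subseteq> Y"
    using h(2) by (auto simp: S_def)
  moreover have "N (x - y) = 1" if "x \<in> S" "y \<in> S" "x \<noteq> y" for x y
    using that dist1 unfolding S_def by blast
  ultimately have "equilateral Y N S"
    unfolding equilateral_def using zero_less_one by blast
  moreover have "finite S"
    by (simp add: S_def)
  ultimately have "enat (CARD('n) - k) \<in> (\<lambda>S. if finite S then enat (card S) else \<infinity>) ` {S. equilateral Y N S}"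
    using cardS by (intro image_eqI[of _ _ S]) simp_all
  then show ?thesis
    unfolding equilateral_dim_def by (rule Sup_upper)
qed

end
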